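(* Let $\gamma>0$, $\varepsilon>0$, $\Lambda\in\mathbb{R}^{m\times n}_{\ge0}$ and $Z\in\mathbb{R}^{m\times n}$. The matrix MLCP $f_{L,\gamma,\Lambda}(Z)=\sum_{i=1}^{m}\sum_{j=1}^{n}f_{L,\gamma,\Lambda_{ij}}(Z_{ij})$ is the optimal value of the following optimization problem: $$f_{L,\gamma,\Lambda}(Z)=\min_{\Omega\in\mathbb{R}^{m\times n}_{\ge0}}\left\{\|Z\|_{L,\Omega}+\frac{\gamma}{2}\|\Omega-\Lambda\|_{F}^{2}\right\},$$ where $\|Z\|_{L,\Omega}=\sum_{i=1}^{m}\sum_{j=1}^{n}\Omega_{ij}\log\left(\frac{|Z_{ij}|}{\varepsilon}+1\right)$ and $\Omega_{ij}\ge0$ are the weights.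
   Context: For scalars $\lambda\ge 0$, $\gamma>0$, $\varepsilon>0$, the (scalar) MLCP function is $$f_{L,\gamma,\lambda}(z)=\begin{cases}\lambda\log\left(\frac{|z|}{\varepsilon}+1\right)-\frac{1}{2\gamma}\log^{2}\left(\frac{|z|}{\varepsilon}+1\right), & |z|\le \varepsilon e^{\gamma\lambda}-\varepsilon,\\[2pt] \frac{\gamma\lambda^{2}}{2}, & |z|>\varepsilon e^{\gamma\lambda}-\varepsilon.\end{cases}$$ For a matrix parameter $\Lambda$ with nonnegative entries, the matrix MLCP applies the scalar function with parameter $\Lambda_{ij}$ to entry $Z_{ij}$ and sums. $\|\cdot\|_F$ is the Frobenius norm. *)

theory Defs
  imports "HOL-Analysis.Analysis"
begin

definition mlcp :: "real \<Rightarrow> real \<Rightarrow> real \<Rightarrow> real \<Rightarrow> real" where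
  "mlcp \<epsilon> \<gamma> l z =
    (if \<bar>z\<bar> \<le> \<epsilon> * exp (\<gamma> * l) - \<epsilon>
     then l * ln (\<bar>z\<bar> / \<epsilon> + 1) - 1 / (2 * \<gamma>) * (ln (\<bar>z\<bar> / \<epsilon> + 1))\<^sup>2
     else \<gamma> * l\<^sup>2 / 2)"

definition mlcp_matrix :: "real \<Rightarrow> real \<Rightarrow> real ^ 'n ^ 'm \<Rightarrow> real ^ 'n ^ 'm \<Rightarrow> real" where
  "mlcp_matrix \<epsilon> \<gamma> \<Lambda> Z = (\<Sum>i\<in>UNIV. \<Sum>j\<in>UNIV. mlcp \<epsilon> \<gamma> (\<Lambda> $ i $ j) (Z $ i $ j))"

definition nonneg_matrices :: "(real ^ 'n ^ 'm) set" where
  "nonneg_matrices = {A. \<forall>i j. 0 \<le> A $ i $ j}"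

definition weighted_log_norm :: "real \<Rightarrow> real ^ 'n ^ 'm \<Rightarrow> real ^ 'n ^ 'm \<Rightarrow> real" where
  "weighted_log_norm \<epsilon> \<Omega> Z =
    (\<Sum>i\<in>UNIV. \<Sum>j\<in>UNIV. \<Omega> $ i $ j * ln (\<bar>Z $ i $ j\<bar> / \<epsilon> + 1))"

text \<open>The library norm on \<^typ>\<open>real ^ 'n ^ 'm\<close> is the Frobenius norm, not an operator norm.\<close>

lemma norm_matrix_eq_frobenius:
  fixes A :: "real ^ 'n ^ 'm"
  shows "norm A = sqrt (\<Sum>i\<in>UNIV. \<Sum>j\<in>UNIV. (A $ i $ j)\<^sup>2)"
  by (simp add: norm_vec_def L2_set_def sum_nonneg)

definition mlcp_objective ::
    "real \<Rightarrow> real \<Rightarrow> real ^ 'n ^ 'm \<Rightarrow> real ^ 'n ^ 'm \<Rightarrow> real ^ 'n ^ 'm \<Rightarrow> real" where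
  "mlcp_objective \<epsilon> \<gamma> \<Lambda> Z \<Omega> =
    weighted_log_norm \<epsilon> \<Omega> Z + \<gamma> / 2 * (norm (\<Omega> - \<Lambda>))\<^sup>2"

end

(* The objective is separable over the entries, so the claim reduces to minimising
   w * t + \<gamma> / 2 * (w - l)^2 over w \<ge> 0 with t = ln (|z| / \<epsilon> + 1). Completing the square, the
   minimiser is the soft threshold max 0 (l - t / \<gamma>), and the branch condition in the
   definition of the MLCP function says precisely that t \<le> \<gamma> * l. *)

theory Submission
  imports Defs
begin

text \<open>Both sides compare the same quantities, before and after the increasing map
  \<open>ln\<close>. The logarithmic form shows the sign of the vertex
  \<open>l - t / \<gamma>\<close>, which drives both case splits below.\<close>

lemma mlcp_branch_iff:
  fixes \<epsilon> \<gamma> l z :: real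
  assumes "\<epsilon> > 0"
  shows "\<bar>z\<bar> \<le> \<epsilon> * exp (\<gamma> * l) - \<epsilon> \<longleftrightarrow> ln (\<bar>z\<bar> / \<epsilon> + 1) \<le> \<gamma> * l"
proof -
  have "\<bar>z\<bar> / \<epsilon> + 1 > 0"
    using assms by (simp add: add_nonneg_pos)
  then have "ln (\<bar>z\<bar> / \<epsilon> + 1) \<le> \<gamma> * l \<longleftrightarrow> \<bar>z\<bar> / \<epsilon> + 1 \<le> exp (\<gamma> * l)"
    by (metis exp_le_cancel_iff exp_ln)
  also have "\<dots> \<longleftrightarrow> \<bar>z\<bar> \<le> \<epsilon> * exp (\<gamma> * l) - \<epsilon>"
    using assms by (simp add: field_simps)
  finally show ?thesis by simp
qed

text \<open>In each branch the gap between the two sides is rewritten as an expression that is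
  visibly nonnegative.\<close>

lemma mlcp_le:
  fixes \<epsilon> \<gamma> l z w :: real
  assumes "\<gamma> > 0" "\<epsilon> > 0" "w \<ge> 0"
  shows "mlcp \<epsilon> \<gamma> l z \<le> w * ln (\<bar>z\<bar> / \<epsilon> + 1) + \<gamma> / 2 * (w - l)\<^sup>2"
proof -
  define t where "t = ln (\<bar>z\<bar> / \<epsilon> + 1)"
  show ?thesis
  proof (cases "t \<le> \<gamma> * l")
    case True
    \<comment> \<open>The subtracted term is the value of the parabola at its vertex
      \<open>w = l - t / \<gamma>\<close>, so the gap is a pure square.\<close>
    have "w * t + \<gamma> / 2 * (w - l)\<^sup>2 - (l * t - 1 / (2 * \<gamma>) * t\<^sup>2)
        = \<gamma> / 2 * (w - l + t / \<gamma>)\<^sup>2"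
      using assms(1) by (simp add: field_simps power2_eq_square)
    moreover have "\<gamma> / 2 * (w - l + t / \<gamma>)\<^sup>2 \<ge> 0"
      using assms(1) by simp
    ultimately show ?thesis
      using True by (simp add: mlcp_def mlcp_branch_iff[OF assms(2)] flip: t_def)
  next
    case False
    \<comment> \<open>Here the vertex is negative, so the comparison is with the boundary value at
      \<open>w = 0\<close>. The linear term is nonnegative because \<open>w \<ge> 0\<close> and
      \<open>t > \<gamma> * l\<close>.\<close>
    have "w * t + \<gamma> / 2 * (w - l)\<^sup>2 - \<gamma> * l\<^sup>2 / 2 = w * (t - \<gamma> * l) + \<gamma> / 2 * w\<^sup>2"
      by (simp add: field_simps power2_eq_square)
    moreover have "w * (t - \<gamma> * l) + \<gamma> / 2 * w\<^sup>2 \<ge> 0"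
      using assms False by simp
    ultimately show ?thesis
      using False by (simp add: mlcp_def mlcp_branch_iff[OF assms(2)] flip: t_def)
  qed
qed

text \<open>The lower bound is attained: a nonnegative vertex is itself feasible, and otherwise
  clipping gives \<open>w = 0\<close>, where only the penalty
  \<open>\<gamma> / 2 * l\<^sup>2\<close> survives.\<close>

lemma mlcp_eq_soft_threshold:
  fixes \<epsilon> \<gamma> l z :: real
  assumes "\<gamma> > 0" "\<epsilon> > 0"
  defines "t \<equiv> ln (\<bar>z\<bar> / \<epsilon> + 1)"
  defines "w \<equiv> max 0 (l - t / \<gamma>)"
  shows "mlcp \<epsilon> \<gamma> l z = w * t + \<gamma> / 2 * (w - l)\<^sup>2"
proof (cases "t \<le> \<gamma> * l")
  case True
  then have "w = l - t / \<gamma>"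
    using assms(1) by (simp add: w_def field_simps)
  moreover have "(l - t / \<gamma>) * t + \<gamma> / 2 * (l - t / \<gamma> - l)\<^sup>2 = l * t - 1 / (2 * \<gamma>) * t\<^sup>2"
    using assms(1) by (simp add: field_simps power2_eq_square)
  ultimately show ?thesis
    using True by (simp add: mlcp_def mlcp_branch_iff[OF assms(2)] flip: t_def)
next
  case False
  then have "w = 0"
    using assms(1) by (simp add: w_def field_simps)
  then show ?thesis
    using False by (simp add: mlcp_def mlcp_branch_iff[OF assms(2)] flip: t_def)
qed

text \<open>Squaring removes the root from the Frobenius norm, so the penalty splits over the
  entries and every weight can be chosen independently.\<close>

lemma mlcp_objective_eq_sum:
  fixes \<Lambda> Z \<Omega> :: "real ^ 'n ^ 'm"
  shows "mlcp_objective \<epsilon> \<gamma> \<Lambda> Z \<Omega> = (\<Sum>i\<in>UNIV. \<Sum>j\<in>UNIV.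
    \<Omega> $ i $ j * ln (\<bar>Z $ i $ j\<bar> / \<epsilon> + 1) + \<gamma> / 2 * (\<Omega> $ i $ j - \<Lambda> $ i $ j)\<^sup>2)"
  by (simp add: mlcp_objective_def weighted_log_norm_def norm_matrix_eq_frobenius
      sum_nonneg sum.distrib sum_distrib_left)

theorem theorem4:
  fixes \<gamma> \<epsilon> :: real and \<Lambda> Z :: "real ^ 'n ^ 'm"
  assumes "\<gamma> > 0" and "\<epsilon> > 0" and "\<Lambda> \<in> nonneg_matrices"
  shows "(\<exists>\<Omega>\<in>nonneg_matrices. mlcp_matrix \<epsilon> \<gamma> \<Lambda> Z = mlcp_objective \<epsilon> \<gamma> \<Lambda> Z \<Omega>)
    \<and> (\<forall>\<Omega>\<in>nonneg_matrices. mlcp_matrix \<epsilon> \<gamma> \<Lambda> Z \<le> mlcp_objective \<epsilon> \<gamma> \<Lambda> Z \<Omega>)"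
proof (intro conjI ballI)
  define \<Omega> :: "real ^ 'n ^ 'm" where
    \<comment> \<open>The scalar minimiser in each entry; the clipping at 0 makes the matrix
      feasible.\<close>
    "\<Omega> = (\<chi> i j. max 0 (\<Lambda> $ i $ j - ln (\<bar>Z $ i $ j\<bar> / \<epsilon> + 1) / \<gamma>))"
  have "\<Omega> \<in> nonneg_matrices"
    by (simp add: \<Omega>_def nonneg_matrices_def)
  moreover have "mlcp_matrix \<epsilon> \<gamma> \<Lambda> Z = mlcp_objective \<epsilon> \<gamma> \<Lambda> Z \<Omega>"
    by (simp add: mlcp_matrix_def mlcp_objective_eq_sum \<Omega>_def mlcp_eq_soft_threshold[OF assms(1,2)])
  ultimately show "\<exists>\<Omega>\<in>nonneg_matrices. mlcp_matrix \<epsilon> \<gamma> \<Lambda> Z = mlcp_objective \<epsilon> \<gamma> \<Lambda> Z \<Omega>"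
    by blast
next
  fix \<Omega> :: "real ^ 'n ^ 'm"
  assume "\<Omega> \<in> nonneg_matrices"
  then show "mlcp_matrix \<epsilon> \<gamma> \<Lambda> Z \<le> mlcp_objective \<epsilon> \<gamma> \<Lambda> Z \<Omega>"
    unfolding mlcp_matrix_def mlcp_objective_eq_sum
    by (intro sum_mono mlcp_le assms(1,2)) (simp add: nonneg_matrices_def)
qed

end
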